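(* Let $q=(q_1,\dots,q_n)\in(\mathbb{R}^2)^n$, $q_i=(x_i,y_i)$, together with positive masses $m=(m_1,\dots,m_n)$, be a planar normalized central configuration with $y_{n-1}=0$ such that $x_{n-1}\neq x_n$ and $x_{n-1}\neq 0$. Then $(q,m)$ is a non-degenerate normalized central configuration if and only if it is a non-degenerate solution of the reduced system $\mathcal{RS}$ (in dimension $d=2$).
   Context: Let $n\ge 2$, masses $m_i>0$, positions $q_i=(x_i,y_i)\in\mathbb{R}^2$ pairwise distinct, $r_{ij}=|q_i-q_j|$. Define $F_i(q_1,\dots,q_n)=q_i-\sum_{j\ne i}\frac{m_j}{r_{ij}^3}(q_i-q_j)$ for $i=1,\dots,n$ and $F=(F_1,\dots,F_n)$. A normalized central configuration (nCC) is $(q,m)$ with $F(q)=0$ (this forces $\sum_i m_iq_i=0$). An nCC is non-degenerate if $\operatorname{rank} DF(q)=dn-\dim(\mathcal{SO}(d)q)$, where $\mathcal{SO}(d)q=\{(Rq_1,\dots,Rq_n): R\in \mathcal{SO}(d)\}$; for $d=2$ this means $\operatorname{rank}DF(q)=2n-1$. Center of mass reduction: $q_n(q_1,\dots,q_{n-1})=-\frac1{m_n}\sum_{i=1}^{n-1}m_iq_i$, and $F^{\mathrm{red}}_i(q_1,\dots,q_{n-1})=F_i(q_1,\dots,q_{n-1},q_n(q_1,\dots,q_{n-1}))$ for $i=1,\dots,n-1$, with components $F^{\mathrm{red}}_i=(F^{\mathrm{red}}_{i,x},F^{\mathrm{red}}_{i,y})$. Reduced system $\mathcal{RS}$ for $d=2$: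 the $2n-3$ equations $F^{\mathrm{red}}_i=0$ ($i=1,\dots,n-2$) and $F^{\mathrm{red}}_{n-1,x}=0$ in the $2n-3$ real unknowns $(q_1,\dots,q_{n-2},x_{n-1})$, where $y_{n-1}$ is set to $0$. A configuration $(q,m)$ is a solution of $\mathcal{RS}$ if these equations hold, $y_{n-1}=0$ and $q_n=q_n(q_1,\dots,q_{n-1})$. It is a non-degenerate solution of $\mathcal{RS}$ if the $(2n-3)\times(2n-3)$ Jacobian matrix of the left-hand sides with respect to these unknowns is invertible at it. *)

theory Defs
  imports "HOL-Analysis.Derivative" "Jordan_Normal_Form.DL_Rank"
begin

unbundle no vec_syntax

type_synonym config = "nat \<Rightarrow> real \<times> real"

text \<open>A planar configuration of \<open>n\<close> bodies is a function on indices of which only the values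
  at \<open>1, \<dots>, n\<close> matter. The norm of \<^typ>\<open>real \<times> real\<close> is the Euclidean one.\<close>

definition admissible :: "nat \<Rightarrow> (nat \<Rightarrow> real) \<Rightarrow> config \<Rightarrow> bool" where
  "admissible n m q \<longleftrightarrow> (\<forall>i\<in>{1..n}. m i > 0) \<and> inj_on q {1..n}"

definition F :: "nat \<Rightarrow> (nat \<Rightarrow> real) \<Rightarrow> config \<Rightarrow> config" where
  "F n m q i = q i - (\<Sum>j\<in>{1..n} - {i}. (m j / norm (q i - q j) ^ 3) *\<^sub>R (q i - q j))"

definition nCC :: "nat \<Rightarrow> (nat \<Rightarrow> real) \<Rightarrow> config \<Rightarrow> bool" where
  "nCC n m q \<longleftrightarrow> admissible n m q \<and> (\<forall>i\<in>{1..n}. F n m q i = 0)"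

text \<open>Coordinates are listed as \<open>x\<^sub>1, y\<^sub>1, x\<^sub>2, y\<^sub>2, \<dots>\<close>, numbered from \<open>0\<close>.\<close>

definition coord :: "config \<Rightarrow> nat \<Rightarrow> real" where
  "coord q k = (if even k then fst (q (k div 2 + 1)) else snd (q (k div 2 + 1)))"

definition config_of_vec :: "real vec \<Rightarrow> config" where
  "config_of_vec z i = (z $ (2 * (i - 1)), z $ (2 * (i - 1) + 1))"

definition jacobian :: "(real vec \<Rightarrow> real vec) \<Rightarrow> real vec \<Rightarrow> real mat" where
  "jacobian f z = mat (dim_vec (f z)) (dim_vec z)
     (\<lambda>(k, l). deriv (\<lambda>t. f (z + t \<cdot>\<^sub>v unit_vec (dim_vec z) l) $ k) 0)"

definition DF :: "nat \<Rightarrow> (nat \<Rightarrow> real) \<Rightarrow> config \<Rightarrow> real mat" where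
  "DF n m q = jacobian (\<lambda>z. vec (2 * n) (coord (F n m (config_of_vec z)))) (vec (2 * n) (coord q))"

text \<open>In the plane the rotation orbit of a configuration that is not identically zero has
  dimension \<open>1\<close>, so the non-degenerate rank is \<open>2 n - 1\<close>.\<close>

definition nondegenerate_nCC :: "nat \<Rightarrow> (nat \<Rightarrow> real) \<Rightarrow> config \<Rightarrow> bool" where
  "nondegenerate_nCC n m q \<longleftrightarrow> nCC n m q \<and> vec_space.rank (2 * n) (DF n m q) = 2 * n - 1"

definition q_last :: "nat \<Rightarrow> (nat \<Rightarrow> real) \<Rightarrow> config \<Rightarrow> real \<times> real" where
  "q_last n m q = - (1 / m n) *\<^sub>R (\<Sum>i=1..n - 1. m i *\<^sub>R q i)"

definition F_red :: "nat \<Rightarrow> (nat \<Rightarrow> real) \<Rightarrow> config \<Rightarrow> config" where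
  "F_red n m q = F n m (q(n := q_last n m q))"

definition RS_solution :: "nat \<Rightarrow> (nat \<Rightarrow> real) \<Rightarrow> config \<Rightarrow> bool" where
  "RS_solution n m q \<longleftrightarrow> admissible n m q \<and>
     (\<forall>i\<in>{1..n - 2}. F_red n m q i = 0) \<and> fst (F_red n m q (n - 1)) = 0 \<and>
     snd (q (n - 1)) = 0 \<and> q n = q_last n m q"

text \<open>In the chosen ordering the unknowns \<open>q\<^sub>1, \<dots>, q\<^bsub>n-2\<^esub>, x\<^bsub>n-1\<^esub>\<close> of the reduced system are the
  first \<open>2 n - 3\<close> coordinates, and its left-hand sides are the first \<open>2 n - 3\<close> components of
  \<^const>\<open>F_red\<close>, evaluated with \<open>y\<^bsub>n-1\<^esub> = 0\<close>.\<close>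

definition RS_config :: "nat \<Rightarrow> real vec \<Rightarrow> config" where
  "RS_config n u = (config_of_vec u)(n - 1 := (u $ (2 * n - 4), 0))"

definition RS_jacobian :: "nat \<Rightarrow> (nat \<Rightarrow> real) \<Rightarrow> config \<Rightarrow> real mat" where
  "RS_jacobian n m q =
     jacobian (\<lambda>u. vec (2 * n - 3) (coord (F_red n m (RS_config n u)))) (vec (2 * n - 3) (coord q))"

definition nondegenerate_RS_solution :: "nat \<Rightarrow> (nat \<Rightarrow> real) \<Rightarrow> config \<Rightarrow> bool" where
  "nondegenerate_RS_solution n m q \<longleftrightarrow> RS_solution n m q \<and> invertible_mat (RS_jacobian n m q)"

end

theory Submission
  imports Defs "Jordan_Normal_Form.Matrix_Kernel"
begin

text \<open>Both notions of non-degeneracy are statements about the kernel of one linear map on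
  configurations, the derivative \<open>L = DF(q)\<close>, and the conservation laws of the \<open>n\<close>-body problem allow the
  two kernels to be compared.

  By rotation invariance \<open>L\<close> annihilates the rotated configuration \<open>Jq\<close>, where \<open>J\<close> is the quarter turn
  (\<open>lin_F_rotation\<close>). By rank-nullity, non-degeneracy of \<open>q\<close> therefore means \<open>ker L = span Jq\<close>
  (\<open>nondegenerate_nCC_iff_kernel\<close>). The reduced system is \<^const>\<open>F\<close> restricted to the configurations with
  \<open>y\<^bsub>n-1\<^esub> = 0\<close> and centre of mass at the origin, with the last three components dropped. Non-degeneracy
  there means that only \<open>v = 0\<close> satisfies both constraints and is sent by \<open>L\<close> to a vector whose first \<open>2 n - 3\<close>
  components vanish (\<open>nondegenerate_RS_iff_kernel\<close>).

  Let \<open>ker L = span Jq\<close>, and let \<open>v\<close> be in the reduced kernel. Conservation of momentum and of angular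
  momentum (\<open>sum_mass_lin_F\<close>, \<open>sum_mass_cross_lin_F\<close>) give three linear relations between the components
  of \<open>Lv\<close>. Since \<open>x\<^bsub>n-1\<^esub> \<noteq> x\<^sub>n\<close>, they force the three dropped components to vanish as well
  (\<open>reduced_kernel_imp_kernel\<close>). So \<open>v\<close> is a multiple \<open>c Jq\<close>, and comparing the \<open>y\<close>-components at body
  \<open>n - 1\<close> gives \<open>c x\<^bsub>n-1\<^esub> = 0\<close>, that is, \<open>v = 0\<close>.

  Conversely, let the reduced kernel be trivial and \<open>Lv = 0\<close>. Since \<open>x\<^bsub>n-1\<^esub> \<noteq> 0\<close>, subtracting a multiple of
  \<open>Jq\<close> makes the \<open>y\<close>-component of \<open>v\<close> at body \<open>n - 1\<close> zero, and conservation of momentum puts the centre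
  of mass of the difference at the origin. The difference is in the reduced kernel, so it vanishes.\<close>

section \<open>Rank, invertibility and kernels of matrices\<close>

text \<open>The rank-nullity theorem for \<open>v \<mapsto> A *\<^sub>v v\<close>: the image of this linear map is the column space,
  whose dimension is the rank.\<close>
lemma rank_plus_kernel_dim:
  fixes A :: "'a :: field mat"
  assumes A: "A \<in> carrier_mat nr nc"
  shows "vec_space.rank nr A + kernel.dim nc A = nc"
proof -
  interpret R: vec_space "TYPE('a)" nr .
  interpret K: kernel nr nc A by (unfold_locales, rule A)
  interpret T: linear_map "class_ring" "module_vec TYPE('a) nc" "module_vec TYPE('a) nr" "\<lambda>v. A *\<^sub>v v"
  proof
    show "(\<lambda>v. A *\<^sub>v v) \<in> module_hom class_ring (module_vec TYPE('a) nc) (module_vec TYPE('a) nr)"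
      using A unfolding module_hom_def
      by (auto simp: module_vec_simps mult_add_distrib_mat_vec mult_mat_vec)
  qed
  have "T.imT = R.col_space A"
    unfolding T.im_def R.col_space_eq[OF A] using A by (auto simp: module_vec_simps)
  moreover have "T.kerT = mat_kernel A"
    unfolding T.ker_def mat_kernel[OF A] using A by (auto simp: module_vec_simps)
  ultimately show ?thesis
    using T.rank_nullity[OF K.NC.fin_dim] K.NC.dim_is_n
    by (simp add: R.rank_def R.col_space_def)
qed

text \<open>By rank-nullity the rank drops by exactly one iff the kernel has dimension one. Since the nonzero
  \<open>w\<close> lies in the kernel, this says that the kernel is the line spanned by \<open>w\<close>.\<close>
lemma rank_eq_pred_iff_kernel_line:
  fixes A :: "'a :: field mat"
  assumes A: "A \<in> carrier_mat nr nc" and w: "w \<in> carrier_vec nc" "w \<noteq> 0\<^sub>v nc" "A *\<^sub>v w = 0\<^sub>v nr"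
  shows "vec_space.rank nr A = nc - 1 \<longleftrightarrow>
    (\<forall>v \<in> carrier_vec nc. A *\<^sub>v v = 0\<^sub>v nr \<longrightarrow> (\<exists>c. v = c \<cdot>\<^sub>v w))" (is "_ \<longleftrightarrow> ?line")
proof -
  interpret K: kernel nr nc A by (unfold_locales, rule A)
  have wK: "w \<in> mat_kernel A" using w mat_kernelI[OF A] by auto
  have "nc \<noteq> 0"
    using w by (auto intro!: eq_vecI)
  have fd: "K.Ker.fin_dim"
    using kernel_basis_exists[OF A] unfolding K.Ker.fin_dim_def K.Ker.basis_def by auto
  have lc: "K.lincomb a {w} = a w \<cdot>\<^sub>v w" for a :: "'a Matrix.vec \<Rightarrow> 'a"
  proof (rule eq_vecI)
    have "dim_vec (K.lincomb a {w}) = nc"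
      unfolding K.lincomb_same[of "{w}" a, simplified, OF wK] using w by (intro K.NC.lincomb_dim) auto
    then show "dim_vec (K.lincomb a {w}) = dim_vec (a w \<cdot>\<^sub>v w)" using w by simp
    show "K.lincomb a {w} $ i = (a w \<cdot>\<^sub>v w) $ i" if "i < dim_vec (a w \<cdot>\<^sub>v w)" for i
      using K.lincomb_index[of i "{w}" a] that w wK by simp
  qed
  have "c \<cdot>\<^sub>v w = 0\<^sub>v nc \<Longrightarrow> c = 0" for c
    using w by (auto simp: vec_eq_iff)
  then have li: "K.lin_indpt {w}"
    unfolding K.Ker.lin_dep_def using lc by (auto simp: subset_singleton_iff)
  have sp: "K.span {w} = {c \<cdot>\<^sub>v w | c. True}"
  proof -
    have "\<exists>a :: 'a Matrix.vec \<Rightarrow> 'a. c \<cdot>\<^sub>v w = K.lincomb a {w}" for c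
      by (rule exI[of _ "\<lambda>_. c"]) (simp add: lc)
    then show ?thesis
      using K.Ker.finite_span[of "{w}"] wK by (auto simp: lc)
  qed
  have "K.span {w} \<subseteq> mat_kernel A"
    using mat_kernel_smult[OF A wK] by (auto simp: sp)
  then have "K.span {w} = mat_kernel A \<longleftrightarrow> (\<forall>v \<in> mat_kernel A. \<exists>c. v = c \<cdot>\<^sub>v w)"
    unfolding sp by blast
  also have "\<dots> \<longleftrightarrow> ?line"
    using A by (auto simp: mat_kernel_def)
  finally have "?line \<longleftrightarrow> K.span {w} = mat_kernel A" ..
  also have "\<dots> \<longleftrightarrow> K.basis {w}"
    unfolding K.Ker.basis_def using li wK by blast
  also have "\<dots> \<longleftrightarrow> K.dim = 1"
    using K.Ker.dim_basis[of "{w}"] K.Ker.dim_li_is_basis[OF fd _ _ li] wK by auto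
  also have "\<dots> \<longleftrightarrow> vec_space.rank nr A = nc - 1"
    using rank_plus_kernel_dim[OF A] \<open>nc \<noteq> 0\<close> by linarith
  finally show ?thesis by blast
qed

lemma invertible_mat_iff_kernel_trivial:
  fixes A :: "'a :: field mat"
  assumes A: "A \<in> carrier_mat n n"
  shows "invertible_mat A \<longleftrightarrow> (\<forall>v \<in> carrier_vec n. A *\<^sub>v v = 0\<^sub>v n \<longrightarrow> v = 0\<^sub>v n)"
proof
  assume "invertible_mat A"
  then obtain B where BA: "B * A = 1\<^sub>m (dim_row B)" and AB: "A * B = 1\<^sub>m n"
    using A unfolding invertible_mat_def inverts_mat_def by auto
  have Bc: "B \<in> carrier_mat n n"
    using arg_cong[OF BA, of dim_col] arg_cong[OF AB, of dim_col] A by auto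
  show "\<forall>v \<in> carrier_vec n. A *\<^sub>v v = 0\<^sub>v n \<longrightarrow> v = 0\<^sub>v n"
  proof (intro ballI impI)
    fix v assume v: "v \<in> carrier_vec n" "A *\<^sub>v v = 0\<^sub>v n"
    have "v = (B * A) *\<^sub>v v" using BA Bc v(1) by simp
    also have "\<dots> = B *\<^sub>v (A *\<^sub>v v)" using Bc A v(1) by (rule assoc_mult_mat_vec)
    also have "\<dots> = 0\<^sub>v n" using v(2) Bc by auto
    finally show "v = 0\<^sub>v n" .
  qed
next
  assume "\<forall>v \<in> carrier_vec n. A *\<^sub>v v = 0\<^sub>v n \<longrightarrow> v = 0\<^sub>v n"
  then have "det A \<noteq> 0" using det_0_iff_vec_prod_zero[OF A] by blast
  then obtain B where "B \<in> carrier_mat n n" "B * A = 1\<^sub>m n" "A * B = 1\<^sub>m n"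
    using det_non_zero_imp_unit[OF A, of "()"] unfolding Units_def ring_mat_def by auto
  then show "invertible_mat A"
    using A unfolding invertible_mat_def inverts_mat_def by auto
qed

section \<open>The derivative of the force field\<close>

text \<open>The derivative of \<open>w \<mapsto> w / |w|\<^sup>3\<close> at \<open>w\<close> in the direction \<open>h\<close>.\<close>
definition kepler_deriv :: "real \<times> real \<Rightarrow> real \<times> real \<Rightarrow> real \<times> real" where
  "kepler_deriv w h = (1 / norm w ^ 3) *\<^sub>R h - (3 * inner w h / norm w ^ 5) *\<^sub>R w"

text \<open>\<open>lin_F n m q v\<close> is \<open>DF(q) v\<close> with the coordinates left out. On configurations the symmetries
  of \<^const>\<open>F\<close> are visible, whereas the matrix hides them.\<close>
definition lin_F :: "nat \<Rightarrow> (nat \<Rightarrow> real) \<Rightarrow> config \<Rightarrow> config \<Rightarrow> config" where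
  "lin_F n m q v i = v i - (\<Sum>j\<in>{1..n} - {i}. m j *\<^sub>R kepler_deriv (q i - q j) (v i - v j))"

text \<open>The infinitesimal generator of the rotation group of the plane.\<close>
definition quarter_turn :: "real \<times> real \<Rightarrow> real \<times> real" where
  "quarter_turn p = (- snd p, fst p)"

text \<open>The planar vector product, which measures angular momentum and torque.\<close>
definition cross :: "real \<times> real \<Rightarrow> real \<times> real \<Rightarrow> real" where
  "cross a b = fst a * snd b - snd a * fst b"

lemma has_derivative_kepler:
  assumes "w \<noteq> 0"
  shows "((\<lambda>w. (c / norm w ^ 3) *\<^sub>R w) has_derivative (\<lambda>h. c *\<^sub>R kepler_deriv w h)) (at w)"
proof -
  have "((\<lambda>w. (c / norm w ^ 3) *\<^sub>R w) has_derivative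
     (\<lambda>h. (c / norm w ^ 3) *\<^sub>R h + (- c * (of_nat 3 * inner h (sgn w) * norm w ^ (3 - 1)) / (norm w ^ 3) ^ 2) *\<^sub>R w)) (at w)"
    using assms
    by (auto intro!: derivative_eq_intros has_derivative_norm simp: fun_eq_iff power2_eq_square field_simps)
  moreover have "(c / norm w ^ 3) *\<^sub>R h + (- c * (of_nat 3 * inner h (sgn w) * norm w ^ (3 - 1)) / (norm w ^ 3) ^ 2) *\<^sub>R w
      = c *\<^sub>R kepler_deriv w h" for h
  proof -
    have "- c * (of_nat 3 * inner h (sgn w) * norm w ^ (3 - 1)) / (norm w ^ 3) ^ 2 = - (c * (3 * inner w h / norm w ^ 5))"
      using assms by (simp add: sgn_div_norm inner_commute field_simps power_def numeral_eq_Suc)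
    then show ?thesis
      by (simp add: kepler_deriv_def scaleR_diff_right)
  qed
  ultimately show ?thesis by simp
qed

lemma kepler_deriv_linear:
  "kepler_deriv w (h + t *\<^sub>R k) = kepler_deriv w h + t *\<^sub>R kepler_deriv w k"
proof -
  have "3 * inner w (h + t *\<^sub>R k) / norm w ^ 5 = 3 * inner w h / norm w ^ 5 + t * (3 * inner w k / norm w ^ 5)"
    by (simp add: inner_add_right add_divide_distrib distrib_left)
  then show ?thesis
    unfolding kepler_deriv_def by (simp only: scaleR_add_left scaleR_add_right scaleR_diff_right scaleR_scaleR mult.commute) simp
qed

lemma kepler_deriv_minus: "kepler_deriv (- w) (- h) = - kepler_deriv w h"
  by (simp add: kepler_deriv_def)

lemma F_has_vector_derivative:
  assumes "inj_on q {1..n}" "i \<in> {1..n}"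
  shows "((\<lambda>t. F n m (\<lambda>i. q i + t *\<^sub>R v i) i) has_vector_derivative lin_F n m q v i) (at 0)"
proof -
  have "((\<lambda>t. (m j / norm (q i + t *\<^sub>R v i - (q j + t *\<^sub>R v j)) ^ 3) *\<^sub>R (q i + t *\<^sub>R v i - (q j + t *\<^sub>R v j)))
      has_vector_derivative m j *\<^sub>R kepler_deriv (q i - q j) (v i - v j)) (at 0)"
    if j: "j \<in> {1..n} - {i}" for j
  proof -
    have "q i - q j \<noteq> 0" using inj_onD[OF assms(1), of i j] assms(2) j by auto
    moreover have "((\<lambda>t. q i + t *\<^sub>R v i - (q j + t *\<^sub>R v j)) has_vector_derivative (v i - v j)) (at 0)"
      by (auto intro!: derivative_eq_intros)
    ultimately show ?thesis
      using vector_derivative_diff_chain_within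
        [of "\<lambda>t. q i + t *\<^sub>R v i - (q j + t *\<^sub>R v j)" "v i - v j" 0 UNIV
          "\<lambda>w. (m j / norm w ^ 3) *\<^sub>R w" "\<lambda>h. m j *\<^sub>R kepler_deriv (q i - q j) h"]
        has_derivative_at_withinI[OF has_derivative_kepler[of "q i - q j" "m j"]]
      by (simp add: o_def)
  qed
  moreover have "((\<lambda>t. q i + t *\<^sub>R v i) has_vector_derivative v i) (at 0)"
    by (auto intro!: derivative_eq_intros)
  ultimately show ?thesis
    unfolding F_def lin_F_def
    by (intro has_vector_derivative_diff has_vector_derivative_sum)
qed

section \<open>Momentum, angular momentum and rotation\<close>

text \<open>Newton's third law: internal forces that come in opposite pairs have zero resultant. Conservation
  of momentum and of angular momentum are both instances.\<close>
lemma sum_antisymmetric_eq_0: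
  fixes f :: "nat \<Rightarrow> nat \<Rightarrow> 'a :: real_vector"
  assumes "finite A" and anti: "\<And>i j. i \<noteq> j \<Longrightarrow> f j i = - f i j"
  shows "(\<Sum>i\<in>A. \<Sum>j\<in>A - {i}. f i j) = 0"
proof -
  define g where "g i j = (if i = j then 0 else f i j)" for i j
  have anti_g: "g j i = - g i j" for i j
    using anti[of i j] by (simp add: g_def)
  have "(\<Sum>i\<in>A. \<Sum>j\<in>A. g i j) = (\<Sum>i\<in>A. \<Sum>j\<in>A. g j i)"
    by (rule sum.swap)
  also have "\<dots> = - (\<Sum>i\<in>A. \<Sum>j\<in>A. g i j)"
    unfolding sum_negf[symmetric] by (intro sum.cong refl anti_g)
  finally have "2 *\<^sub>R (\<Sum>i\<in>A. \<Sum>j\<in>A. g i j) = 0"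
    unfolding scaleR_2 by (rule eq_neg_iff_add_eq_0[THEN iffD1])
  moreover have "(\<Sum>i\<in>A. \<Sum>j\<in>A - {i}. f i j) = (\<Sum>i\<in>A. \<Sum>j\<in>A. g i j)"
    using assms(1) by (intro sum.cong refl sum.mono_neutral_cong_left) (auto simp: g_def)
  ultimately show ?thesis by simp
qed

text \<open>The forces between the bodies cancel, so only the linear term of \<^const>\<open>F\<close> contributes. At a
  zero of \<^const>\<open>F\<close> the centre of mass is therefore the origin.\<close>
lemma sum_mass_F: "(\<Sum>i=1..n. m i *\<^sub>R F n m q i) = (\<Sum>i=1..n. m i *\<^sub>R q i)"
proof -
  have "(\<Sum>i=1..n. \<Sum>j\<in>{1..n} - {i}. m i *\<^sub>R (m j / norm (q i - q j) ^ 3) *\<^sub>R (q i - q j)) = 0"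
    by (rule sum_antisymmetric_eq_0)
      (auto simp: norm_minus_commute algebra_simps)
  then show ?thesis
    by (simp add: F_def scaleR_diff_right sum_subtractf scaleR_sum_right)
qed

text \<open>The linearization of the previous identity: on the kernel of \<^const>\<open>lin_F\<close> the constraint on
  the centre of mass holds automatically.\<close>
lemma sum_mass_lin_F: "(\<Sum>i=1..n. m i *\<^sub>R lin_F n m q v i) = (\<Sum>i=1..n. m i *\<^sub>R v i)"
proof -
  have "(\<Sum>i=1..n. \<Sum>j\<in>{1..n} - {i}. m i *\<^sub>R m j *\<^sub>R kepler_deriv (q i - q j) (v i - v j)) = 0"
  proof (rule sum_antisymmetric_eq_0)
    show "m j *\<^sub>R m i *\<^sub>R kepler_deriv (q j - q i) (v j - v i)
      = - (m i *\<^sub>R m j *\<^sub>R kepler_deriv (q i - q j) (v i - v j))" for i j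
      using kepler_deriv_minus[of "q i - q j" "v i - v j"] by simp
  qed simp
  then show ?thesis
    by (simp add: lin_F_def scaleR_diff_right sum_subtractf scaleR_sum_right)
qed

lemma cross_simps:
  "cross (a - b) c = cross a c - cross b c" "cross c (a - b) = cross c a - cross c b"
  "cross (r *\<^sub>R a) c = r * cross a c" "cross c (r *\<^sub>R a) = r * cross c a"
  "cross (- a) c = - cross a c" "cross a a = 0"
  by (simp_all add: cross_def algebra_simps)

lemma cross_commute: "cross a b = - cross b a"
  by (simp add: cross_def)

lemma cross_sum: "cross (\<Sum>j\<in>A. f j) c = (\<Sum>j\<in>A. cross (f j) c)"
  by (simp add: cross_def fst_sum snd_sum sum_distrib_right sum_subtractf)

text \<open>The total torque \<open>\<Sum> m\<^sub>i F\<^sub>i \<times> q\<^sub>i\<close> vanishes identically in \<open>q\<close>, because the forces are central; this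
  is its derivative in the direction \<open>v\<close>. The summands are grouped so that the contributions of each pair of
  bodies are opposite, which avoids differentiating the sum.\<close>
lemma sum_mass_cross_lin_F:
  "(\<Sum>i=1..n. m i * (cross (lin_F n m q v i) (q i) + cross (F n m q i) (v i))) = 0"
proof -
  define f where "f i j = m i * m j * (cross (kepler_deriv (q i - q j) (v i - v j)) (q i)
    + cross (q i - q j) (v i) / norm (q i - q j) ^ 3)" for i j
  have anti: "f j i = - f i j" for i j
  proof -
    define w h where "w = q i - q j" and "h = v i - v j"
    have eq: "q j - q i = - w" "v j - v i = - h" "kepler_deriv (- w) (- h) = - kepler_deriv w h"
      by (simp_all only: kepler_deriv_minus) (simp_all add: w_def h_def)
    have fij: "f i j = m i * m j * (cross (kepler_deriv w h) (q i) + cross w (v i) / norm w ^ 3)"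
      by (simp only: f_def w_def h_def)
    have fji: "f j i = m i * m j * (- cross (kepler_deriv w h) (q j) - cross w (v j) / norm w ^ 3)"
      by (simp only: f_def eq cross_simps norm_minus_cancel) (simp add: mult.commute)
    have Kw: "cross (kepler_deriv w h) w = cross (kepler_deriv w h) (q i) - cross (kepler_deriv w h) (q j)"
      by (simp only: cross_simps w_def)
    have wh: "cross w h = cross w (v i) - cross w (v j)"
      by (simp only: cross_simps h_def)
    have "f i j + f j i = m i * m j * (cross (kepler_deriv w h) w + cross w h / norm w ^ 3)"
      unfolding fij fji Kw wh by (simp add: diff_divide_distrib algebra_simps)
    also have "cross (kepler_deriv w h) w + cross w h / norm w ^ 3 = 0"
      using cross_commute[of h w] by (simp add: kepler_deriv_def cross_simps)
    finally show ?thesis by simp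
  qed
  have "(\<Sum>i=1..n. \<Sum>j\<in>{1..n} - {i}. f i j) = 0"
    by (intro sum_antisymmetric_eq_0 finite_atLeastAtMost anti)
  moreover have "m i * (cross (lin_F n m q v i) (q i) + cross (F n m q i) (v i))
      = - (\<Sum>j\<in>{1..n} - {i}. f i j)" for i
  proof -
    have lin: "cross (lin_F n m q v i) (q i) = cross (v i) (q i)
        - (\<Sum>j\<in>{1..n} - {i}. m j * cross (kepler_deriv (q i - q j) (v i - v j)) (q i))"
      unfolding lin_F_def by (simp only: cross_simps cross_sum)
    have F: "cross (F n m q i) (v i) = - cross (v i) (q i)
        - (\<Sum>j\<in>{1..n} - {i}. m j * (cross (q i - q j) (v i) / norm (q i - q j) ^ 3))"
      unfolding F_def cross_simps(1)[of "q i" "sum _ _"] cross_sum cross_simps(3)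
      by (simp add: cross_commute[of "q i" "v i"])
    have sum_f: "(\<Sum>j\<in>{1..n} - {i}. f i j)
        = m i * ((\<Sum>j\<in>{1..n} - {i}. m j * cross (kepler_deriv (q i - q j) (v i - v j)) (q i))
          + (\<Sum>j\<in>{1..n} - {i}. m j * (cross (q i - q j) (v i) / norm (q i - q j) ^ 3)))"
      by (simp only: f_def sum_distrib_left sum.distrib distrib_left mult.assoc)
    show ?thesis unfolding lin F sum_f by (simp only: algebra_simps)
  qed
  ultimately show ?thesis by (simp add: sum_negf)
qed

text \<open>The infinitesimal form of the equivariance \<open>F(Rq) = R F(q)\<close>: at a central configuration the
  tangent to the rotation orbit lies in the kernel.\<close>
lemma lin_F_rotation: "lin_F n m q (\<lambda>i. quarter_turn (q i)) i = quarter_turn (F n m q i)"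
proof -
  have diff: "quarter_turn (a - b) = quarter_turn a - quarter_turn b" for a b
    by (simp add: quarter_turn_def)
  have scale: "quarter_turn (r *\<^sub>R a) = r *\<^sub>R quarter_turn a" for r a
    by (simp add: quarter_turn_def)
  have sum: "quarter_turn (\<Sum>j\<in>A. f j) = (\<Sum>j\<in>A. quarter_turn (f j))" for A and f :: "nat \<Rightarrow> real \<times> real"
    by (simp add: quarter_turn_def prod_eq_iff fst_sum snd_sum sum_negf)
  have "kepler_deriv w (quarter_turn w) = (1 / norm w ^ 3) *\<^sub>R quarter_turn w" for w
    by (simp add: kepler_deriv_def quarter_turn_def inner_prod_def)
  then show ?thesis
    unfolding lin_F_def F_def diff[symmetric] by (simp add: diff[of "q i" "sum _ _"] sum scale)
qed

section \<open>Jacobian matrices of parametrized configurations\<close>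

lemma lin_F_linear:
  "lin_F n m q (\<lambda>i. v i + t *\<^sub>R w i) i = lin_F n m q v i + t *\<^sub>R lin_F n m q w i"
proof -
  have "v i + t *\<^sub>R w i - (v j + t *\<^sub>R w j) = (v i - v j) + t *\<^sub>R (w i - w j)" for j
    by (simp add: algebra_simps)
  then have "(\<Sum>j\<in>{1..n} - {i}. m j *\<^sub>R kepler_deriv (q i - q j) (v i + t *\<^sub>R w i - (v j + t *\<^sub>R w j)))
      = (\<Sum>j\<in>{1..n} - {i}. m j *\<^sub>R kepler_deriv (q i - q j) (v i - v j))
        + t *\<^sub>R (\<Sum>j\<in>{1..n} - {i}. m j *\<^sub>R kepler_deriv (q i - q j) (w i - w j))"
    by (simp only: kepler_deriv_linear) (simp add: scaleR_sum_right sum.distrib scaleR_add_right mult.commute)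
  then show ?thesis
    unfolding lin_F_def by (simp add: scaleR_diff_right)
qed

lemma lin_F_cong:
  assumes "\<And>i. i \<in> {1..n} \<Longrightarrow> q i = q' i" "\<And>i. i \<in> {1..n} \<Longrightarrow> v i = v' i" "i \<in> {1..n}"
  shows "lin_F n m q v i = lin_F n m q' v' i"
  using assms by (simp add: lin_F_def)

lemma F_cong:
  assumes "\<And>i. i \<in> {1..n} \<Longrightarrow> q i = q' i" "i \<in> {1..n}"
  shows "F n m q i = F n m q' i"
  using assms by (simp add: F_def)

text \<open>A linear functional is determined by its values on the unit vectors. Linearity is required only on
  vectors of the right dimension, since vectors of all dimensions share one type.\<close>
lemma linear_on_vec_eq_sum:
  fixes g :: "real vec \<Rightarrow> real"
  assumes lin: "\<And>z w t. z \<in> carrier_vec d \<Longrightarrow> w \<in> carrier_vec d \<Longrightarrow> g (z + t \<cdot>\<^sub>v w) = g z + t * g w"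
    and u: "u \<in> carrier_vec d"
  shows "g u = (\<Sum>l<d. u $ l * g (unit_vec d l))"
proof -
  \<comment> \<open>Build up \<open>u\<close> one coordinate at a time.\<close>
  define trunc where "trunc k = vec d (\<lambda>l. if l < k then u $ l else 0)" for k
  have "k \<le> d \<Longrightarrow> g (trunc k) = (\<Sum>l<k. u $ l * g (unit_vec d l))" for k
  proof (induction k)
    case 0
    have "trunc 0 = 0\<^sub>v d" by (auto simp: trunc_def)
    then show ?case using lin[of "0\<^sub>v d" "0\<^sub>v d" 1] by simp
  next
    case (Suc k)
    have "trunc (Suc k) = trunc k + u $ k \<cdot>\<^sub>v unit_vec d k"
      by (rule eq_vecI) (auto simp: trunc_def unit_vec_def less_Suc_eq)
    then show ?case using Suc lin[of "trunc k" "unit_vec d k" "u $ k"] by (simp add: trunc_def)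
  qed
  moreover have "trunc d = u" using u by (auto simp: trunc_def)
  ultimately show ?thesis by fastforce
qed

lemma coord_linear: "coord (\<lambda>i. v i + t *\<^sub>R w i) k = coord v k + t * coord w k"
  by (simp add: coord_def)

lemma coord_has_real_derivative:
  assumes "((\<lambda>t. G t (k div 2 + 1)) has_vector_derivative D (k div 2 + 1)) (at t)"
  shows "((\<lambda>t. coord (G t) k) has_real_derivative coord D k) (at t)"
  using bounded_linear.has_vector_derivative[OF bounded_linear_fst assms]
    bounded_linear.has_vector_derivative[OF bounded_linear_snd assms]
  by (simp add: coord_def has_real_derivative_iff_has_vector_derivative)

text \<open>The chain rule for \<^const>\<open>F\<close> after a linear parametrization \<open>\<Phi>\<close> of configurations. Both Jacobian
  matrices of the problem are of this form: \<open>\<Phi>\<close> only unpacks the coordinates for the full system, and it also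
  restores \<open>y\<^bsub>n-1\<^esub> = 0\<close> and \<open>q\<^sub>n\<close> for the reduced one.\<close>
lemma jacobian_F_mult_vec:
  assumes lin: "\<And>z w t i. z \<in> carrier_vec d \<Longrightarrow> w \<in> carrier_vec d \<Longrightarrow> i \<in> {1..n} \<Longrightarrow>
      \<Phi> (z + t \<cdot>\<^sub>v w) i = \<Phi> z i + t *\<^sub>R \<Phi> w i"
    and base: "\<And>i. i \<in> {1..n} \<Longrightarrow> \<Phi> z i = q i"
    and inj: "inj_on q {1..n}" and M: "M \<le> 2 * n"
    and z: "z \<in> carrier_vec d" and u: "u \<in> carrier_vec d"
  shows "jacobian (\<lambda>z. vec M (coord (F n m (\<Phi> z)))) z *\<^sub>v u = vec M (coord (lin_F n m q (\<Phi> u)))"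
    (is "?J *\<^sub>v u = _")
proof (rule eq_vecI)
  fix k assume "k < dim_vec (vec M (coord (lin_F n m q (\<Phi> u))))"
  then have k: "k < M" "k div 2 + 1 \<in> {1..n}" using M by auto
  define g where "g u = coord (lin_F n m q (\<Phi> u)) k" for u
  have coord_cong: "coord v k = coord v' k" if "v (k div 2 + 1) = v' (k div 2 + 1)" for v v'
    using that by (simp add: coord_def)
  have "g (x + t \<cdot>\<^sub>v y) = g x + t * g y" if "x \<in> carrier_vec d" "y \<in> carrier_vec d" for x y t
  proof -
    have "lin_F n m q (\<Phi> (x + t \<cdot>\<^sub>v y)) (k div 2 + 1)
        = lin_F n m q (\<lambda>i. \<Phi> x i + t *\<^sub>R \<Phi> y i) (k div 2 + 1)"
      using that k(2) by (intro lin_F_cong lin) auto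
    then show ?thesis
      unfolding g_def coord_linear[symmetric] lin_F_linear by (rule coord_cong)
  qed
  then have gu: "g u = (\<Sum>l<d. u $ l * g (unit_vec d l))"
    using u by (rule linear_on_vec_eq_sum)
  have "deriv (\<lambda>t. vec M (coord (F n m (\<Phi> (z + t \<cdot>\<^sub>v unit_vec d l)))) $ k) 0 = g (unit_vec d l)" for l
  proof (rule DERIV_imp_deriv)
    let ?e = "unit_vec d l :: real vec"
    have "\<Phi> (z + t \<cdot>\<^sub>v ?e) i = q i + t *\<^sub>R \<Phi> ?e i" if "i \<in> {1..n}" for t i
      using lin[OF z, of ?e i t] base[OF that] that by simp
    then have "F n m (\<Phi> (z + t \<cdot>\<^sub>v ?e)) (k div 2 + 1) = F n m (\<lambda>i. q i + t *\<^sub>R \<Phi> ?e i) (k div 2 + 1)" for t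
      using k by (intro F_cong) auto
    then have "((\<lambda>t. coord (F n m (\<Phi> (z + t \<cdot>\<^sub>v ?e))) k) has_real_derivative g ?e) (at 0)"
      unfolding g_def using F_has_vector_derivative[OF inj k(2)]
      by (intro coord_has_real_derivative) simp
    then show "((\<lambda>t. vec M (coord (F n m (\<Phi> (z + t \<cdot>\<^sub>v ?e)))) $ k) has_real_derivative g ?e) (at 0)"
      using k by simp
  qed
  then have "(?J *\<^sub>v u) $ k = g u"
    unfolding gu using k u z
    by (simp add: jacobian_def scalar_prod_def atLeast0LessThan mult.commute)
  then show "(?J *\<^sub>v u) $ k = vec M (coord (lin_F n m q (\<Phi> u))) $ k"
    using k by (simp add: g_def)
qed (simp add: jacobian_def)

lemma jacobian_carrier: "(\<And>z. dim_vec (f z) = M) \<Longrightarrow> z \<in> carrier_vec d \<Longrightarrow> jacobian f z \<in> carrier_mat M d"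
  by (auto simp: jacobian_def)

section \<open>Coordinates of the full and of the reduced system\<close>

text \<open>The linear embedding of the reduced unknowns into the configurations with \<open>y\<^bsub>n-1\<^esub> = 0\<close> and
  centre of mass at the origin. Precomposing \<^const>\<open>F\<close> with it gives the reduced system.\<close>
definition RS_embed :: "nat \<Rightarrow> (nat \<Rightarrow> real) \<Rightarrow> real vec \<Rightarrow> config" where
  "RS_embed n m u = (RS_config n u)(n := q_last n m (RS_config n u))"

lemma vec_coord_eq_0_iff:
  "vec (2 * n) (coord v) = 0\<^sub>v (2 * n) \<longleftrightarrow> (\<forall>i\<in>{1..n}. v i = 0)"
proof
  assume L: "vec (2 * n) (coord v) = 0\<^sub>v (2 * n)"
  show "\<forall>i\<in>{1..n}. v i = 0"
  proof
    fix i assume i: "i \<in> {1..n}"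
    then have "coord v (2 * (i - 1)) = 0" "coord v (2 * (i - 1) + 1) = 0"
      using L by (auto simp: vec_eq_iff)
    then show "v i = 0" using i by (simp add: coord_def prod_eq_iff)
  qed
qed (auto simp: vec_eq_iff coord_def)

lemma config_of_vec_coord: "i \<in> {1..n} \<Longrightarrow> config_of_vec (vec (2 * n) (coord v)) i = v i"
  by (auto simp: config_of_vec_def coord_def prod_eq_iff)

lemma coord_config_of_vec:
  assumes "z \<in> carrier_vec (2 * n)"
  shows "vec (2 * n) (coord (config_of_vec z)) = z"
  using assms by (auto simp: coord_def config_of_vec_def intro!: eq_vecI)

lemma config_of_vec_linear:
  "z \<in> carrier_vec (2 * n) \<Longrightarrow> w \<in> carrier_vec (2 * n) \<Longrightarrow> i \<in> {1..n} \<Longrightarrow>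
    config_of_vec (z + t \<cdot>\<^sub>v w) i = config_of_vec z i + t *\<^sub>R config_of_vec w i"
  by (auto simp: config_of_vec_def prod_eq_iff)

lemma RS_config_linear:
  assumes "n \<ge> 2" "z \<in> carrier_vec (2 * n - 3)" "w \<in> carrier_vec (2 * n - 3)" "i \<in> {1..n - 1}"
  shows "RS_config n (z + t \<cdot>\<^sub>v w) i = RS_config n z i + t *\<^sub>R RS_config n w i"
proof -
  have "i = n - 1 \<or> 2 * (i - 1) + 1 < 2 * n - 3" using assms by auto
  then show ?thesis using assms
    by (auto simp: RS_config_def config_of_vec_def prod_eq_iff)
qed

lemma q_last_linear:
  assumes "\<And>i. i \<in> {1..n - 1} \<Longrightarrow> p i = q i + t *\<^sub>R r i"
  shows "q_last n m p = q_last n m q + t *\<^sub>R q_last n m r"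
proof -
  have "(\<Sum>i=1..n - 1. m i *\<^sub>R p i) = (\<Sum>i=1..n - 1. m i *\<^sub>R q i) + t *\<^sub>R (\<Sum>i=1..n - 1. m i *\<^sub>R r i)"
    using assms by (simp add: scaleR_add_right sum.distrib scaleR_sum_right mult.commute)
  then show ?thesis by (simp add: q_last_def scaleR_add_right)
qed

lemma RS_embed_linear:
  assumes "n \<ge> 2" "z \<in> carrier_vec (2 * n - 3)" "w \<in> carrier_vec (2 * n - 3)" "i \<in> {1..n}"
  shows "RS_embed n m (z + t \<cdot>\<^sub>v w) i = RS_embed n m z i + t *\<^sub>R RS_embed n m w i"
proof (cases "i = n")
  case True
  then show ?thesis
    using q_last_linear[of n "RS_config n (z + t \<cdot>\<^sub>v w)"] RS_config_linear[OF assms(1-3)]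
    by (simp add: RS_embed_def)
next
  case False
  then have "i \<in> {1..n - 1}" using assms by auto
  then show ?thesis using RS_config_linear[OF assms(1-3)] False by (simp add: RS_embed_def)
qed

lemma mass_sum_eq_0_iff_q_last:
  assumes "n \<ge> 1" "m n \<noteq> 0"
  shows "(\<Sum>i=1..n. m i *\<^sub>R v i) = 0 \<longleftrightarrow> v n = q_last n m v"
proof -
  define S where "S = (\<Sum>i=1..n - 1. m i *\<^sub>R v i)"
  have "{1..n} = insert n {1..n - 1}" using assms by auto
  then have "(\<Sum>i=1..n. m i *\<^sub>R v i) = m n *\<^sub>R v n + S"
    using assms by (simp add: S_def)
  moreover have "m n *\<^sub>R v n + S = 0 \<longleftrightarrow> v n = - (1 / m n) *\<^sub>R S"
    using assms(2) by (auto simp: prod_eq_iff field_simps add_eq_0_iff)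
  ultimately show ?thesis by (simp add: q_last_def S_def)
qed

lemma q_last_cong: "(\<And>i. i \<in> {1..n - 1} \<Longrightarrow> p i = q i) \<Longrightarrow> q_last n m p = q_last n m q"
  by (simp add: q_last_def)

text \<open>With \<open>vec_coord_RS_embed\<close> below, this shows that \<^const>\<open>RS_embed\<close> is a bijection onto the
  configurations that satisfy the two constraints, up to values outside \<open>1, \<dots>, n\<close>. Kernel vectors of the
  reduced Jacobian matrix can therefore be treated as constrained configurations.\<close>
lemma RS_embed_coord:
  assumes "n \<ge> 2" "snd (v (n - 1)) = 0" "v n = q_last n m v" "i \<in> {1..n}"
  shows "RS_embed n m (vec (2 * n - 3) (coord v)) i = v i"
proof -
  have low: "RS_config n (vec (2 * n - 3) (coord v)) i = v i" if "i \<in> {1..n - 1}" for i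
  proof (cases "i = n - 1")
    case True
    \<comment> \<open>The last unknown, number \<open>2 n - 4\<close>, is \<open>x\<^bsub>n-1\<^esub>\<close>.\<close>
    have "(2 * n - 4) div 2 + 1 = n - 1" "even (2 * n - 4)" "2 * n - 4 < 2 * n - 3" using assms(1) by auto
    then show ?thesis
      using True assms(2) by (simp add: RS_config_def coord_def prod_eq_iff)
  next
    case False
    then have "2 * (i - 1) + 1 < 2 * n - 3" "i - 1 + 1 = i" using that by auto
    then show ?thesis using False that by (simp add: RS_config_def config_of_vec_def coord_def prod_eq_iff)
  qed
  then have "q_last n m (RS_config n (vec (2 * n - 3) (coord v))) = v n"
    unfolding assms(3) by (rule q_last_cong)
  then show ?thesis
    using low[of i] assms(4) by (auto simp: RS_embed_def)
qed

lemma RS_embed_constraints: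
  assumes "n \<ge> 2" "m n \<noteq> 0"
  shows "snd (RS_embed n m u (n - 1)) = 0"
    and "(\<Sum>i=1..n. m i *\<^sub>R RS_embed n m u i) = 0"
proof -
  show "snd (RS_embed n m u (n - 1)) = 0"
    using assms by (simp add: RS_embed_def RS_config_def)
  have "q_last n m (RS_embed n m u) = q_last n m (RS_config n u)"
    using assms by (intro q_last_cong) (auto simp: RS_embed_def)
  then show "(\<Sum>i=1..n. m i *\<^sub>R RS_embed n m u i) = 0"
    using assms by (subst mass_sum_eq_0_iff_q_last) (auto simp: RS_embed_def)
qed

lemma vec_coord_RS_embed:
  assumes "n \<ge> 2" "u \<in> carrier_vec (2 * n - 3)"
  shows "vec (2 * n - 3) (coord (RS_embed n m u)) = u"
proof (rule eq_vecI)
  fix k assume "k < dim_vec u"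
  then have k: "k < 2 * n - 3" "k div 2 + 1 \<noteq> n" using assms by auto
  show "vec (2 * n - 3) (coord (RS_embed n m u)) $ k = u $ k"
  proof (cases "k = 2 * n - 4")
    case True
    have "(2 * n - 4) div 2 + 1 = n - 1" "even (2 * n - 4)" using assms(1) by auto
    then show ?thesis using k True by (simp add: coord_def RS_embed_def RS_config_def)
  next
    case False
    then have "k div 2 + 1 \<noteq> n - 1" using k by auto
    then show ?thesis using k by (auto simp: coord_def RS_embed_def RS_config_def config_of_vec_def)
  qed
qed (use assms in auto)

lemma vec_coord_reduced_eq_0_iff:
  assumes "n \<ge> 2"
  shows "vec (2 * n - 3) (coord v) = 0\<^sub>v (2 * n - 3) \<longleftrightarrow> (\<forall>i\<in>{1..n - 2}. v i = 0) \<and> fst (v (n - 1)) = 0"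
proof
  assume "vec (2 * n - 3) (coord v) = 0\<^sub>v (2 * n - 3)"
  then have L: "coord v k = 0" if "k < 2 * n - 3" for k
    using that by (auto simp: vec_eq_iff)
  have "v i = 0" if i: "i \<in> {1..n - 2}" for i
  proof -
    have "coord v (2 * (i - 1)) = 0" "coord v (2 * (i - 1) + 1) = 0"
      using i by (auto intro!: L)
    then show "v i = 0" using i by (simp add: coord_def prod_eq_iff)
  qed
  moreover have "fst (v (n - 1)) = 0"
  proof -
    have "(2 * n - 4) div 2 + 1 = n - 1" "even (2 * n - 4)" "2 * n - 4 < 2 * n - 3" using assms by auto
    then show ?thesis using L[of "2 * n - 4"] by (simp add: coord_def)
  qed
  ultimately show "(\<forall>i\<in>{1..n - 2}. v i = 0) \<and> fst (v (n - 1)) = 0" by blast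
next
  assume R: "(\<forall>i\<in>{1..n - 2}. v i = 0) \<and> fst (v (n - 1)) = 0"
  have "coord v k = 0" if k: "k < 2 * n - 3" for k
  proof (cases "k = 2 * n - 4")
    case True
    have "(2 * n - 4) div 2 + 1 = n - 1" "even (2 * n - 4)" using assms(1) by auto
    then show ?thesis using R True by (simp add: coord_def)
  next
    case False
    then have "k div 2 + 1 \<in> {1..n - 2}" using k by auto
    then show ?thesis using R by (simp add: coord_def)
  qed
  then show "vec (2 * n - 3) (coord v) = 0\<^sub>v (2 * n - 3)" by (auto simp: vec_eq_iff)
qed

lemma DF_mult_vec:
  assumes "inj_on q {1..n}" "u \<in> carrier_vec (2 * n)"
  shows "DF n m q *\<^sub>v u = vec (2 * n) (coord (lin_F n m q (config_of_vec u)))"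
  unfolding DF_def using assms
  by (intro jacobian_F_mult_vec[where d = "2 * n"] config_of_vec_linear config_of_vec_coord) auto

lemma RS_jacobian_mult_vec:
  assumes "n \<ge> 2" and "inj_on q {1..n}" "snd (q (n - 1)) = 0" "q n = q_last n m q"
    "u \<in> carrier_vec (2 * n - 3)"
  shows "RS_jacobian n m q *\<^sub>v u = vec (2 * n - 3) (coord (lin_F n m q (RS_embed n m u)))"
  unfolding RS_jacobian_def F_red_def RS_embed_def[symmetric] using assms
  by (intro jacobian_F_mult_vec[where d = "2 * n - 3"] RS_embed_linear RS_embed_coord) auto

section \<open>Non-degeneracy in terms of kernels\<close>

text \<open>The tangent to the rotation orbit always lies in the kernel, so the rank is \<open>2 n - 1\<close> exactly when the
  kernel contains nothing else. The body \<open>i0\<close> away from the origin makes this tangent nonzero.\<close>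
lemma nondegenerate_nCC_iff_kernel:
  assumes q: "nCC n m q" and i0: "i0 \<in> {1..n}" "q i0 \<noteq> 0"
  shows "nondegenerate_nCC n m q \<longleftrightarrow>
    (\<forall>v. (\<forall>i\<in>{1..n}. lin_F n m q v i = 0) \<longrightarrow> (\<exists>c. \<forall>i\<in>{1..n}. v i = c *\<^sub>R quarter_turn (q i)))"
proof -
  define w where "w = vec (2 * n) (coord (\<lambda>i. quarter_turn (q i)))"
  have inj: "inj_on q {1..n}" and F0: "\<And>i. i \<in> {1..n} \<Longrightarrow> F n m q i = 0"
    using q by (auto simp: nCC_def admissible_def)
  have A: "DF n m q \<in> carrier_mat (2 * n) (2 * n)"
    unfolding DF_def by (intro jacobian_carrier) auto
  have wc: "w \<in> carrier_vec (2 * n)" by (simp add: w_def)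
  have w0: "w \<noteq> 0\<^sub>v (2 * n)"
    using i0 unfolding w_def vec_coord_eq_0_iff by (auto simp: quarter_turn_def prod_eq_iff)
  have kernel: "DF n m q *\<^sub>v vec (2 * n) (coord v) = 0\<^sub>v (2 * n) \<longleftrightarrow> (\<forall>i\<in>{1..n}. lin_F n m q v i = 0)" for v
  proof -
    have "lin_F n m q (config_of_vec (vec (2 * n) (coord v))) i = lin_F n m q v i" if "i \<in> {1..n}" for i
      using that by (intro lin_F_cong config_of_vec_coord) auto
    then show ?thesis by (simp add: DF_mult_vec[OF inj] vec_coord_eq_0_iff)
  qed
  have line: "vec (2 * n) (coord v) = c \<cdot>\<^sub>v w \<longleftrightarrow> (\<forall>i\<in>{1..n}. v i = c *\<^sub>R quarter_turn (q i))" for v c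
  proof -
    have "vec (2 * n) (coord v) = c \<cdot>\<^sub>v w \<longleftrightarrow>
        vec (2 * n) (coord (\<lambda>i. v i + (- c) *\<^sub>R quarter_turn (q i))) = 0\<^sub>v (2 * n)"
      unfolding coord_linear w_def by (auto simp: vec_eq_iff)
    then show ?thesis by (simp add: vec_coord_eq_0_iff)
  qed
  have "DF n m q *\<^sub>v w = 0\<^sub>v (2 * n)"
    unfolding w_def kernel lin_F_rotation using F0 by (simp add: quarter_turn_def zero_prod_def)
  from rank_eq_pred_iff_kernel_line[OF A wc w0 this]
  have "nondegenerate_nCC n m q \<longleftrightarrow>
      (\<forall>v\<in>carrier_vec (2 * n). DF n m q *\<^sub>v v = 0\<^sub>v (2 * n) \<longrightarrow> (\<exists>c. v = c \<cdot>\<^sub>v w))"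
    using q by (simp add: nondegenerate_nCC_def)
  also have "\<dots> \<longleftrightarrow> (\<forall>v. DF n m q *\<^sub>v vec (2 * n) (coord v) = 0\<^sub>v (2 * n)
      \<longrightarrow> (\<exists>c. vec (2 * n) (coord v) = c \<cdot>\<^sub>v w))"
    by (metis coord_config_of_vec vec_carrier)
  finally show ?thesis unfolding kernel line .
qed

lemma nCC_imp_RS_solution:
  assumes n: "n \<ge> 2" and q: "nCC n m q" and y: "snd (q (n - 1)) = 0"
  shows "q n = q_last n m q" and "RS_solution n m q"
proof -
  have adm: "admissible n m q" and F0: "\<And>i. i \<in> {1..n} \<Longrightarrow> F n m q i = 0"
    using q by (auto simp: nCC_def)
  have "(\<Sum>i=1..n. m i *\<^sub>R q i) = 0"
    using sum_mass_F[of m n q] F0 by simp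
  moreover have "m n \<noteq> 0" using adm n by (auto simp: admissible_def dest!: bspec[of _ _ n])
  ultimately show last: "q n = q_last n m q"
    using mass_sum_eq_0_iff_q_last[of n m q] n by simp
  then have "F_red n m q = F n m q" by (simp add: F_red_def flip: last)
  then show "RS_solution n m q"
    using F0 n adm y last by (auto simp: RS_solution_def)
qed

text \<open>An invertible reduced Jacobian matrix has trivial kernel. Its kernel consists of the constrained
  configurations on which the first \<open>2 n - 3\<close> components of \<^const>\<open>lin_F\<close> vanish.\<close>
lemma nondegenerate_RS_iff_kernel:
  assumes n: "n \<ge> 2" and q: "nCC n m q" and y: "snd (q (n - 1)) = 0"
  shows "nondegenerate_RS_solution n m q \<longleftrightarrow>
    (\<forall>v. snd (v (n - 1)) = 0 \<longrightarrow> (\<Sum>i=1..n. m i *\<^sub>R v i) = 0 \<longrightarrow>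
      (\<forall>i\<in>{1..n - 2}. lin_F n m q v i = 0) \<longrightarrow> fst (lin_F n m q v (n - 1)) = 0 \<longrightarrow> (\<forall>i\<in>{1..n}. v i = 0))"
    (is "_ \<longleftrightarrow> ?trivial")
proof -
  have inj: "inj_on q {1..n}" and "m n > 0"
    using q n by (simp_all add: nCC_def admissible_def)
  then have mn: "m n \<noteq> 0" by simp
  note last = nCC_imp_RS_solution(1)[OF assms]
  have A: "RS_jacobian n m q \<in> carrier_mat (2 * n - 3) (2 * n - 3)"
    unfolding RS_jacobian_def by (intro jacobian_carrier) auto
  have kernel: "RS_jacobian n m q *\<^sub>v u = 0\<^sub>v (2 * n - 3) \<longleftrightarrow>
      (\<forall>i\<in>{1..n - 2}. lin_F n m q (RS_embed n m u) i = 0) \<and> fst (lin_F n m q (RS_embed n m u) (n - 1)) = 0"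
    if "u \<in> carrier_vec (2 * n - 3)" for u
    unfolding RS_jacobian_mult_vec[OF n inj y last that] by (rule vec_coord_reduced_eq_0_iff[OF n])
  have "nondegenerate_RS_solution n m q \<longleftrightarrow>
      (\<forall>u\<in>carrier_vec (2 * n - 3). RS_jacobian n m q *\<^sub>v u = 0\<^sub>v (2 * n - 3) \<longrightarrow> u = 0\<^sub>v (2 * n - 3))"
    using nCC_imp_RS_solution(2)[OF assms] invertible_mat_iff_kernel_trivial[OF A]
    by (simp add: nondegenerate_RS_solution_def)
  also have "\<dots> \<longleftrightarrow> ?trivial"
  proof (intro iffI allI impI ballI)
    fix v i
    assume triv: "\<forall>u\<in>carrier_vec (2 * n - 3). RS_jacobian n m q *\<^sub>v u = 0\<^sub>v (2 * n - 3) \<longrightarrow> u = 0\<^sub>v (2 * n - 3)"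
      and v: "snd (v (n - 1)) = 0" "(\<Sum>i=1..n. m i *\<^sub>R v i) = 0"
        "\<forall>i\<in>{1..n - 2}. lin_F n m q v i = 0" "fst (lin_F n m q v (n - 1)) = 0"
      and i: "i \<in> {1..n}"
    define u where "u = vec (2 * n - 3) (coord v)"
    have vn: "v n = q_last n m v"
      using mass_sum_eq_0_iff_q_last[of n m v] v(2) n mn by simp
    have emb: "RS_embed n m u i = v i" if "i \<in> {1..n}" for i
      unfolding u_def using that by (intro RS_embed_coord n v(1) vn)
    have "lin_F n m q (RS_embed n m u) i = lin_F n m q v i" if "i \<in> {1..n}" for i
      using that by (intro lin_F_cong emb) auto
    then have "RS_jacobian n m q *\<^sub>v u = 0\<^sub>v (2 * n - 3)"
      using v n by (subst kernel) (auto simp: u_def)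
    then have "u = 0\<^sub>v (2 * n - 3)" using triv by (simp add: u_def)
    then have "(\<forall>i\<in>{1..n - 2}. v i = 0) \<and> fst (v (n - 1)) = 0"
      unfolding u_def by (rule vec_coord_reduced_eq_0_iff[OF n, THEN iffD1])
    then have low: "v i = 0" if "i \<in> {1..n - 1}" for i
      using that v(1) by (cases "i = n - 1") (auto simp: prod_eq_iff)
    then have "v n = 0" unfolding vn q_last_def by simp
    then show "v i = 0" using low i by (cases "i = n") auto
  next
    fix u :: "real vec"
    assume triv: ?trivial and u: "u \<in> carrier_vec (2 * n - 3)" "RS_jacobian n m q *\<^sub>v u = 0\<^sub>v (2 * n - 3)"
    have "\<forall>i\<in>{1..n}. RS_embed n m u i = 0"
      using triv RS_embed_constraints[of n m u, OF n mn] u kernel by blast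
    then have "vec (2 * n - 3) (coord (RS_embed n m u)) = 0\<^sub>v (2 * n - 3)"
      using n by (subst vec_coord_reduced_eq_0_iff) auto
    then show "u = 0\<^sub>v (2 * n - 3)"
      by (simp add: vec_coord_RS_embed[OF n u(1)])
  qed
  finally show ?thesis .
qed

text \<open>The three equations left out of the reduced system follow from the two conservation laws. Put
  \<open>w = lin_F n m q v\<close>, so that only \<open>w\<^bsub>n-1\<^esub> = (0, s)\<close> and \<open>w\<^sub>n\<close> can be nonzero. Vanishing momentum gives
  \<open>m\<^sub>n w\<^sub>n = - m\<^bsub>n-1\<^esub> w\<^bsub>n-1\<^esub>\<close>, and then vanishing torque gives \<open>m\<^bsub>n-1\<^esub> s (x\<^sub>n - x\<^bsub>n-1\<^esub>) = 0\<close>.\<close>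
lemma reduced_kernel_imp_kernel:
  assumes n: "n \<ge> 2" and q: "nCC n m q" and x: "fst (q (n - 1)) \<noteq> fst (q n)"
    and v: "(\<Sum>i=1..n. m i *\<^sub>R v i) = 0" "\<forall>i\<in>{1..n - 2}. lin_F n m q v i = 0" "fst (lin_F n m q v (n - 1)) = 0"
    and i: "i \<in> {1..n}"
  shows "lin_F n m q v i = 0"
proof -
  let ?w = "lin_F n m q v"
  have split: "{1..n} = {1..n - 2} \<union> {n - 1, n}" "n - 1 \<noteq> n" using n by auto
  have disj: "{1..n - 2} \<inter> {n - 1, n} = {}" by auto
  have pos: "m (n - 1) > 0" "m n > 0" and F0: "\<And>i. i \<in> {1..n} \<Longrightarrow> F n m q i = 0"
    using q n by (auto simp: nCC_def admissible_def)
  have two: "(\<Sum>i=1..n. g i) = g (n - 1) + g n" if "\<And>i. i \<in> {1..n - 2} \<Longrightarrow> g i = 0" for g :: "nat \<Rightarrow> 'a :: real_vector"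
  proof -
    have "(\<Sum>i=1..n. g i) = (\<Sum>i=1..n - 2. g i) + (\<Sum>i\<in>{n - 1, n}. g i)"
      unfolding split(1) using disj by (intro sum.union_disjoint) auto
    then show ?thesis using split(2) that by simp
  qed
  have mom: "m (n - 1) *\<^sub>R ?w (n - 1) + m n *\<^sub>R ?w n = 0"
    using two[of "\<lambda>i. m i *\<^sub>R ?w i"] v sum_mass_lin_F[of m n q v] by simp
  have "(\<Sum>i=1..n. m i * cross (?w i) (q i)) = 0"
  proof -
    have "m i * (cross (?w i) (q i) + cross (F n m q i) (v i)) = m i * cross (?w i) (q i)" if "i \<in> {1..n}" for i
      using F0[OF that] by (simp add: cross_def)
    then have "(\<Sum>i=1..n. m i * (cross (?w i) (q i) + cross (F n m q i) (v i))) = (\<Sum>i=1..n. m i * cross (?w i) (q i))"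
      by (rule sum.cong[OF refl])
    then show ?thesis
      unfolding sum_mass_cross_lin_F by (rule sym)
  qed
  then have ang: "m (n - 1) * cross (?w (n - 1)) (q (n - 1)) + m n * cross (?w n) (q n) = 0"
    using two[of "\<lambda>i. m i * cross (?w i) (q i)"] v(2) by (simp add: cross_def)
  define b where "b = m (n - 1) * snd (?w (n - 1))"
  have "m n * fst (?w n) = 0" "m n * snd (?w n) = - b"
    using mom v(3) by (auto simp: prod_eq_iff b_def)
  then have "m n * cross (?w n) (q n) = b * fst (q n)"
    by (simp add: cross_def right_diff_distrib flip: mult.assoc)
  moreover have "m (n - 1) * cross (?w (n - 1)) (q (n - 1)) = - b * fst (q (n - 1))"
    using v(3) by (simp add: cross_def b_def)
  ultimately have "b * (fst (q n) - fst (q (n - 1))) = 0"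
    using ang by (simp add: right_diff_distrib)
  then have "b = 0" using x by simp
  then have "?w (n - 1) = 0" using v(3) pos by (simp add: b_def prod_eq_iff)
  moreover from this have "?w n = 0" using mom pos by simp
  ultimately show ?thesis using v(2) i split(1) by blast
qed

theorem theorem8:
  fixes n :: nat and m :: "nat \<Rightarrow> real" and q :: "nat \<Rightarrow> real \<times> real"
  assumes "n \<ge> 2"
    and "nCC n m q"
    and "snd (q (n - 1)) = 0"
    and "fst (q (n - 1)) \<noteq> fst (q n)"
    and "fst (q (n - 1)) \<noteq> 0"
  shows "nondegenerate_nCC n m q \<longleftrightarrow> nondegenerate_RS_solution n m q"
proof -
  have idx: "n - 1 \<in> {1..n}" using assms(1) by auto
  have "q (n - 1) \<noteq> 0" using assms(5) by auto
  note full = nondegenerate_nCC_iff_kernel[OF assms(2) idx this]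
  note red = nondegenerate_RS_iff_kernel[OF assms(1-3)]
  have rot0: "lin_F n m q (\<lambda>i. quarter_turn (q i)) i = 0" if "i \<in> {1..n}" for i
    unfolding lin_F_rotation
    using that assms(2) by (simp add: nCC_def quarter_turn_def zero_prod_def)
  show ?thesis
    unfolding full red
  proof (intro iffI allI impI)
    fix v
    assume line: "\<forall>v. (\<forall>i\<in>{1..n}. lin_F n m q v i = 0) \<longrightarrow> (\<exists>c. \<forall>i\<in>{1..n}. v i = c *\<^sub>R quarter_turn (q i))"
      and v: "snd (v (n - 1)) = 0" "(\<Sum>i=1..n. m i *\<^sub>R v i) = 0"
        "\<forall>i\<in>{1..n - 2}. lin_F n m q v i = 0" "fst (lin_F n m q v (n - 1)) = 0"
    have "\<forall>i\<in>{1..n}. lin_F n m q v i = 0"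
      using reduced_kernel_imp_kernel[OF assms(1,2,4) v(2-4)] by blast
    then obtain c where c: "\<forall>i\<in>{1..n}. v i = c *\<^sub>R quarter_turn (q i)" using line by blast
    \<comment> \<open>Normalizing \<open>y\<^bsub>n-1\<^esub> = 0\<close> excludes rotations, as these move body \<open>n - 1\<close> vertically.\<close>
    then have "c * fst (q (n - 1)) = 0" using v(1) idx by (auto simp: quarter_turn_def)
    then show "\<forall>i\<in>{1..n}. v i = 0" using c assms(5) by simp
  next
    fix v
    assume triv: "\<forall>v. snd (v (n - 1)) = 0 \<longrightarrow> (\<Sum>i=1..n. m i *\<^sub>R v i) = 0 \<longrightarrow>
        (\<forall>i\<in>{1..n - 2}. lin_F n m q v i = 0) \<longrightarrow> fst (lin_F n m q v (n - 1)) = 0 \<longrightarrow> (\<forall>i\<in>{1..n}. v i = 0)"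
      and v: "\<forall>i\<in>{1..n}. lin_F n m q v i = 0"
    \<comment> \<open>Subtract the infinitesimal rotation that moves body \<open>n - 1\<close> vertically as \<open>v\<close> does; this needs \<open>x\<^bsub>n-1\<^esub> \<noteq> 0\<close>.\<close>
    define c where "c = snd (v (n - 1)) / fst (q (n - 1))"
    define v' where "v' = (\<lambda>i. v i + (- c) *\<^sub>R quarter_turn (q i))"
    have ker: "lin_F n m q v' i = 0" if "i \<in> {1..n}" for i
      unfolding v'_def lin_F_linear using v rot0 that by simp
    have "snd (v' (n - 1)) = 0" using assms(5) by (simp add: v'_def c_def quarter_turn_def)
    moreover have "(\<Sum>i=1..n. m i *\<^sub>R v' i) = 0"
      unfolding sum_mass_lin_F[symmetric, of m v' n q] using ker by (intro sum.neutral) auto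
    moreover have "\<forall>i\<in>{1..n - 2}. lin_F n m q v' i = 0" "fst (lin_F n m q v' (n - 1)) = 0"
      using ker idx by auto
    ultimately have "\<forall>i\<in>{1..n}. v' i = 0" using triv by blast
    then show "\<exists>c. \<forall>i\<in>{1..n}. v i = c *\<^sub>R quarter_turn (q i)"
      by (intro exI[of _ c]) (simp add: v'_def)
  qed
qed

end
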